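(* Let $n\ge 1$ be an integer and let $B_n^2$ be the strong prism of the linear polyomino chain $B_n$ with $n$ squares. Then the number $\tau(B_n^2)$ of spanning trees of $B_n^2$ is $$\tau(B_n^2)=\sqrt{3}\cdot 27\cdot 2^{8n-3}\left[(2+\sqrt{3})^{n+1}-(2-\sqrt{3})^{n+1}\right].$$
   Context: All graphs are simple and undirected. The linear polyomino chain $B_n$ with $n$ squares is the graph with $2n+2$ vertices $u_1,\dots,u_{n+1},v_1,\dots,v_{n+1}$ and $3n+1$ edges: $u_iu_{i+1}$ and $v_iv_{i+1}$ for $1\le i\le n$, and $u_iv_i$ for $1\le i\le n+1$. The strong product $G\boxtimes H$ of graphs $G$ and $H$ has vertex set $V(G)\times V(H)$, where two distinct vertices $(a_1,b_1)$ and $(a_2,b_2)$ are adjacent whenever $a_1,a_2$ are equal or adjacent in $G$ and $b_1,b_2$ are equal or adjacent in $H$. The strong prism of $G$ is the strong product of $G$ and $K_2$ (the complete graph on two vertices). $B_n^2$ denotes the strong prism of $B_n$; it has $4n+4$ vertices and $2(7n+3)$ edges. $\tau(G)$ denotes the number of (labeled) spanning trees of $G$. *)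

theory Defs
  imports Complex_Main "Graph_Theory.Graph_Theory"
begin

text \<open>
  As usual for this graph library, an undirected simple graph is a finite symmetric digraph without
  loops or parallel arcs (locales \<^locale>\<open>graph\<close> and \<^locale>\<open>pair_graph\<close>): every undirected edge is
  represented by its two orientations.
\<close>

datatype ladder_vertex = Upper nat | Lower nat

text \<open>\<open>Upper i\<close> is the vertex $u_i$ and \<open>Lower i\<close> is the vertex $v_i$.\<close>

definition polyomino_edges :: "nat \<Rightarrow> (ladder_vertex \<times> ladder_vertex) set" where
  "polyomino_edges n =
     {(Upper i, Upper (i + 1)) | i. 1 \<le> i \<and> i \<le> n}
     \<union> {(Lower i, Lower (i + 1)) | i. 1 \<le> i \<and> i \<le> n}
     \<union> {(Upper i, Lower i) | i. 1 \<le> i \<and> i \<le> n + 1}"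

definition linear_polyomino_chain :: "nat \<Rightarrow> ladder_vertex pair_pre_digraph" where
  "linear_polyomino_chain n =
     \<lparr> pverts = Upper ` {1..n + 1} \<union> Lower ` {1..n + 1},
       parcs = polyomino_edges n \<union> (polyomino_edges n)\<inverse> \<rparr>"

definition strong_product ::
  "'a pair_pre_digraph \<Rightarrow> 'b pair_pre_digraph \<Rightarrow> ('a \<times> 'b) pair_pre_digraph" where
  "strong_product G H =
     \<lparr> pverts = pverts G \<times> pverts H,
       parcs = {((a1, b1), (a2, b2)) | a1 b1 a2 b2.
         (a1, b1) \<in> pverts G \<times> pverts H \<and> (a2, b2) \<in> pverts G \<times> pverts H \<and>
         (a1, b1) \<noteq> (a2, b2) \<and>
         (a1 = a2 \<or> (a1, a2) \<in> parcs G) \<and>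
         (b1 = b2 \<or> (b1, b2) \<in> parcs H)} \<rparr>"

definition K2 :: "bool pair_pre_digraph" where
  "K2 = \<lparr> pverts = UNIV, parcs = {(x, y). x \<noteq> y} \<rparr>"

definition strong_prism :: "'a pair_pre_digraph \<Rightarrow> ('a \<times> bool) pair_pre_digraph" where
  "strong_prism G = strong_product G K2"

text \<open>
  The library predicates \<^const>\<open>tree\<close> and \<^const>\<open>spanning_tree\<close> are not the undirected notions on
  symmetric digraphs: their acyclicity condition also forbids the closed walk $a, b, a$, which is a
  directed cycle of length 2 for every undirected edge. An undirected cycle is a directed one of
  length at least 3.
\<close>

definition undirected_tree :: "('a, 'b) pre_digraph \<Rightarrow> bool" where
  "undirected_tree T \<longleftrightarrow>
     graph T \<and> connected T \<and> \<not> (\<exists>p. pre_digraph.cycle T p \<and> 3 \<le> length p)"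

definition undirected_spanning_trees :: "'a pair_pre_digraph \<Rightarrow> 'a pair_pre_digraph set" where
  "undirected_spanning_trees G =
     {T. undirected_tree (with_proj T) \<and> spanning (with_proj T) (with_proj G)}"

definition num_spanning_trees :: "'a pair_pre_digraph \<Rightarrow> nat" where
  "num_spanning_trees G = card (undirected_spanning_trees G)"


lemma polyomino_edges_image:
  "polyomino_edges n =
     (\<lambda>i. (Upper i, Upper (i + 1))) ` {1..n}
     \<union> (\<lambda>i. (Lower i, Lower (i + 1))) ` {1..n}
     \<union> (\<lambda>i. (Upper i, Lower i)) ` {1..n + 1}"
  unfolding polyomino_edges_def by auto

lemma finite_polyomino_edges: "finite (polyomino_edges n)"
  unfolding polyomino_edges_image by blast

lemma card_polyomino_edges: "card (polyomino_edges n) = 3 * n + 1"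
  unfolding polyomino_edges_image
  by (subst card_Un_disjoint, force, force, force)+ (simp add: card_image inj_on_def)

lemma polyomino_edges_asym: "polyomino_edges n \<inter> (polyomino_edges n)\<inverse> = {}"
  unfolding polyomino_edges_def by auto

lemma pair_graph_linear_polyomino_chain: "pair_graph (linear_polyomino_chain n)"
proof
  show "symmetric (with_proj (linear_polyomino_chain n))"
    by (auto simp: symmetric_def sym_def linear_polyomino_chain_def)
qed (auto simp: linear_polyomino_chain_def finite_polyomino_edges, auto simp: polyomino_edges_def)

lemma card_verts_linear_polyomino_chain:
  "card (pverts (linear_polyomino_chain n)) = 2 * n + 2"
  unfolding linear_polyomino_chain_def
  by simp (subst card_Un_disjoint, auto simp: card_image inj_on_def)

lemma card_arcs_linear_polyomino_chain:
  "card (parcs (linear_polyomino_chain n)) = 2 * (3 * n + 1)"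
  unfolding linear_polyomino_chain_def
  by (simp add: card_Un_disjoint finite_polyomino_edges polyomino_edges_asym card_polyomino_edges)

lemma K2_complete: "complete_digraph 2 (with_proj K2)"
  unfolding complete_digraph_pair_def by (auto simp: K2_def)

lemma pair_graph_strong_product:
  assumes "pair_graph G" "pair_graph H"
  shows "pair_graph (strong_product G H)"
proof -
  interpret G: pair_graph G by fact
  interpret H: pair_graph H by fact
  have "parcs (strong_product G H)
      \<subseteq> (pverts G \<times> pverts H) \<times> (pverts G \<times> pverts H)"
    by (auto simp: strong_product_def)
  then have fin: "finite (parcs (strong_product G H))"
    by (rule finite_subset) (use G.pair_finite_verts H.pair_finite_verts in blast)
  have symG: "(b, a) \<in> parcs G" if "(a, b) \<in> parcs G" for a b
    using G.sym_arcs that by (auto simp: symmetric_def sym_def)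
  have symH: "(b, a) \<in> parcs H" if "(a, b) \<in> parcs H" for a b
    using H.sym_arcs that by (auto simp: symmetric_def sym_def)
  show ?thesis
  proof
    show "symmetric (with_proj (strong_product G H))"
      unfolding symmetric_def sym_def strong_product_def
      by (auto dest: symG symH)
  qed (use fin G.pair_finite_verts H.pair_finite_verts in \<open>auto simp: strong_product_def\<close>)
qed

lemma pair_graph_strong_prism:
  assumes "pair_graph G"
  shows "pair_graph (strong_prism G)"
  unfolding strong_prism_def
  by (intro pair_graph_strong_product assms pair_graphI_complete[OF K2_complete])

lemma card_verts_strong_prism_linear_polyomino_chain:
  "card (pverts (strong_prism (linear_polyomino_chain n))) = 4 * n + 4"
  by (simp add: strong_prism_def strong_product_def K2_def card_cartesian_product
      card_verts_linear_polyomino_chain)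

text \<open>Twice the $2(7n+3)$ undirected edges, one arc for each orientation.\<close>

lemma card_arcs_strong_prism_linear_polyomino_chain:
  "card (parcs (strong_prism (linear_polyomino_chain n))) = 2 * (2 * (7 * n + 3))"
proof -
  let ?B = "linear_polyomino_chain n"
  interpret B: pair_graph ?B by (rule pair_graph_linear_polyomino_chain)
  define f where "f = (\<lambda>((a1::ladder_vertex, a2::ladder_vertex), b1::bool, b2::bool). ((a1, b1), (a2, b2)))"
  define g where "g = (\<lambda>(a::ladder_vertex, b::bool). ((a, b), (a, \<not> b)))"
  have "parcs (strong_prism ?B) = f ` (parcs ?B \<times> UNIV) \<union> g ` (pverts ?B \<times> UNIV)"
    (is "?L = ?F \<union> ?G")
  proof
    show "?L \<subseteq> ?F \<union> ?G"
    proof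
      fix x assume "x \<in> ?L"
      then obtain a1 b1 a2 b2 where x: "x = ((a1, b1), (a2, b2))" "a1 \<in> pverts ?B"
        "(a1, b1) \<noteq> (a2, b2)" "a1 = a2 \<or> (a1, a2) \<in> parcs ?B"
        by (auto simp: strong_prism_def strong_product_def)
      show "x \<in> ?F \<union> ?G"
      proof (cases "a1 = a2")
        case True
        then have "x = g (a1, b1)" using x by (auto simp: g_def)
        then show ?thesis using x(2) by blast
      next
        case False
        then have "x = f ((a1, a2), b1, b2)" "(a1, a2) \<in> parcs ?B" using x by (auto simp: f_def)
        then show ?thesis by blast
      qed
    qed
    show "?F \<union> ?G \<subseteq> ?L"
      using B.wellformed' B.pair_no_loops
      by (fastforce simp: f_def g_def strong_prism_def strong_product_def K2_def)
  qed
  moreover have "?F \<inter> ?G = {}"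
    using B.pair_no_loops by (fastforce simp: f_def g_def)
  moreover have "card ?F = 4 * card (parcs ?B)"
    by (subst card_image) (auto simp: f_def inj_on_def card_cartesian_product UNIV_Times_UNIV[symmetric]
        simp del: UNIV_Times_UNIV)
  moreover have "card ?G = 2 * card (pverts ?B)"
    by (subst card_image) (auto simp: g_def inj_on_def card_cartesian_product)
  moreover have "finite ?F" "finite ?G"
    using B.pair_finite_arcs B.pair_finite_verts by auto
  ultimately show ?thesis
    by (simp add: card_Un_disjoint card_arcs_linear_polyomino_chain card_verts_linear_polyomino_chain)
qed

end

theory Submission
  imports "Jordan_Normal_Form.Determinant" Defs
begin

text \<open>
  Why the formula holds. The matrix-tree theorem turns the count into a determinant, and the
  symmetries of the graph split that determinant twice.

  The version of the matrix-tree theorem used here (\<open>matrix_tree\<close>) perturbs a single row: adding any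
  vector \<open>x\<close> to the row of the Laplacian that belongs to a root \<open>r\<close> gives a matrix whose determinant
  is the sum of \<open>x\<close> times the number of spanning trees. It rests on the correspondence between
  spanning trees and parent maps, which send every vertex other than \<open>r\<close> to a neighbour so that
  iteration always ends in \<open>r\<close> (\<open>num_spanning_trees_parent_maps\<close>). Multilinearity expands the
  determinant into a sum over all maps to neighbours, where a parent map contributes \<open>1\<close> and any
  other map \<open>0\<close>.

  The freedom in \<open>x\<close> is what keeps the symmetry of the graph usable. If a graph consists of two
  copies of the same vertex set that can be exchanged, its Laplacian has two-by-two block form with
  equal diagonal blocks and equal off-diagonal blocks. With \<open>x\<close> chosen alike on both copies, the
  perturbed matrix still has equal column sums of blocks, and its determinant is a product of two
  determinants of half the size (\<open>det_folded_blocks\<close>).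

  Exchanging the twins \<open>(v, False)\<close> and \<open>(v, True)\<close> of a strong prism, the two factors are twice a
  rooted Laplacian of \<open>G\<close> and the diagonal matrix with entries \<open>2 * (deg v + 1)\<close>. Hence, for \<open>N\<close> vertices,
  four times the number of spanning trees of the prism is $4^N \prod_v (\deg v + 1)$ times that of \<open>G\<close>
  (\<open>num_spanning_trees_strong_prism\<close>). Exchanging the upper and the lower side of the chain, the two
  factors are the rooted Laplacian of a path, of determinant \<open>1\<close>, and the path Laplacian plus twice
  the identity, a tridiagonal matrix whose leading minors satisfy $D_{k+2} = 4 D_{k+1} - D_k$. The
  roots of $t^2 = 4t - 1$ are $2 \pm \sqrt 3$, which produces the powers in the formula. The
  remaining factors come from the degrees: four corners of degree two, all other vertices of degree
  three.
\<close>

section \<open>Spanning trees and parent maps\<close>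

text \<open>
  The value \<open>r\<close> at the root makes reaching the root a statement about iterates of the map, and the
  extensional function space makes a parent map determined by its values on the vertices, so that
  cardinalities are meaningful.
\<close>
definition parent_maps :: "'a pair_pre_digraph \<Rightarrow> 'a \<Rightarrow> ('a \<Rightarrow> 'a) set" where
  "parent_maps G r =
     {f \<in> (\<Pi>\<^sub>E v\<in>pverts G. if v = r then {r} else parcs G `` {v}).
        \<forall>v\<in>pverts G. \<exists>k. (f ^^ k) v = r}"

definition parent_tree :: "'a pair_pre_digraph \<Rightarrow> 'a \<Rightarrow> ('a \<Rightarrow> 'a) \<Rightarrow> 'a pair_pre_digraph" where
  "parent_tree G r f =
     \<lparr> pverts = pverts G,
       parcs = (\<lambda>v. (v, f v)) ` (pverts G - {r}) \<union> (\<lambda>v. (f v, v)) ` (pverts G - {r}) \<rparr>"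

definition depth :: "'a \<Rightarrow> ('a \<Rightarrow> 'a) \<Rightarrow> 'a \<Rightarrow> nat" where
  "depth r f v = (LEAST k. (f ^^ k) v = r)"

lemma depth_parent:
  assumes "(f ^^ k) v = r" "v \<noteq> r"
  shows "depth r f v = Suc (depth r f (f v))"
  unfolding depth_def using Least_Suc[where P = "\<lambda>k. (f ^^ k) v = r", OF assms(1)] assms(2)
  by (simp add: funpow_swap1)

lemma parent_mapsD:
  assumes "f \<in> parent_maps G r"
  shows "v \<in> pverts G \<Longrightarrow> v \<noteq> r \<Longrightarrow> (v, f v) \<in> parcs G"
    and "r \<in> pverts G \<Longrightarrow> f r = r"
    and "v \<in> pverts G \<Longrightarrow> \<exists>k. (f ^^ k) v = r"
    and "v \<notin> pverts G \<Longrightarrow> f v = undefined"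
  using assms unfolding parent_maps_def by (auto simp: PiE_iff extensional_def split: if_splits)

lemma depth_parent_maps:
  assumes "f \<in> parent_maps G r" "v \<in> pverts G" "v \<noteq> r"
  shows "depth r f v = Suc (depth r f (f v))"
  using depth_parent[OF _ assms(3)] parent_mapsD(3)[OF assms(1,2)] by blast

lemma strongly_connected_imp_connected:
  assumes "pair_graph G" "strongly_connected (with_proj G)"
  shows "connected (with_proj G)"
proof -
  interpret pair_graph G by fact
  show ?thesis
    using assms(2) reachable_mk_symmetric_eq[OF sym_arcs]
    unfolding connected_def strongly_connected_def by simp
qed

lemma pair_graph_parent_tree:
  assumes "pair_graph G" and f: "f \<in> parent_maps G r"
  shows "pair_graph (parent_tree G r f)"
proof -
  interpret G: pair_graph G by fact
  note arc = parent_mapsD(1)[OF f]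
  show ?thesis
  proof
    show "symmetric (with_proj (parent_tree G r f))"
      by (auto simp: symmetric_def sym_def parent_tree_def)
  qed (use arc G.in_arcsD2 G.pair_finite_verts G.pair_no_loops in
      \<open>fastforce simp: parent_tree_def\<close>)+
qed

lemma parent_tree_subset:
  assumes "pair_graph G" and f: "f \<in> parent_maps G r"
  shows "parcs (parent_tree G r f) \<subseteq> parcs G"
proof -
  interpret G: pair_graph G by fact
  show ?thesis
    using parent_mapsD(1)[OF f] G.arcs_symmetric by (auto simp: parent_tree_def)
qed

lemma strongly_connected_parent_tree:
  assumes "pair_graph G" and r: "r \<in> pverts G" and f: "f \<in> parent_maps G r"
  shows "strongly_connected (with_proj (parent_tree G r f))"
proof -
  interpret G: pair_graph G by fact
  interpret T: pair_graph "parent_tree G r f" by (rule pair_graph_parent_tree) fact+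
  have to_root: "v \<rightarrow>\<^sup>*\<^bsub>with_proj (parent_tree G r f)\<^esub> r" if "v \<in> pverts G" for v
    using that
  proof (induction "depth r f v" arbitrary: v rule: less_induct)
    case less
    show ?case
    proof (cases "v = r")
      case True
      then show ?thesis using T.reachable_refl less.prems by (simp add: parent_tree_def)
    next
      case False
      then have "(v, f v) \<in> parcs (parent_tree G r f)"
        using less.prems by (auto simp: parent_tree_def)
      moreover have "f v \<rightarrow>\<^sup>*\<^bsub>with_proj (parent_tree G r f)\<^esub> r"
        using less depth_parent_maps[OF f less.prems False] parent_mapsD(1)[OF f less.prems False]
          G.in_arcsD2 by auto
      ultimately show ?thesis
        using T.adj_reachable_trans by auto
    qed
  qed
  show ?thesis
  proof
    show "verts (with_proj (parent_tree G r f)) \<noteq> {}"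
      using r by (auto simp: parent_tree_def)
    fix u v
    assume "u \<in> verts (with_proj (parent_tree G r f))" "v \<in> verts (with_proj (parent_tree G r f))"
    then have "u \<in> pverts G" "v \<in> pverts G" by (auto simp: parent_tree_def)
    then show "u \<rightarrow>\<^sup>*\<^bsub>with_proj (parent_tree G r f)\<^esub> v"
      using to_root T.reachable_trans symmetric_reachable[OF T.sym_arcs] by blast
  qed
qed


lemma pcas_nth:
  "pcas u p v \<Longrightarrow> Suc i < length p \<Longrightarrow> snd (p ! i) = fst (p ! Suc i)"
  by (induction u p v arbitrary: i rule: pcas.induct)
     (auto simp: nth_Cons split: nat.splits, metis pcas.elims(2) nth_Cons_0)

text \<open>Every arc of the tree joins a vertex to its parent, whose depth is one less; the depths tell which
  end is the parent.\<close>
lemma parent_tree_arc_to_parent: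
  assumes f: "f \<in> parent_maps G r" and ab: "(a, b) \<in> parcs (parent_tree G r f)"
    and le: "depth r f a \<le> depth r f b"
  shows "a = f b"
  using ab le depth_parent_maps[OF f] by (force simp: parent_tree_def)

text \<open>
  A deepest vertex of a cycle has both of its neighbours on the cycle as parent, so these two
  coincide, which is impossible in a cycle of length at least three.
\<close>
lemma no_long_cycle_parent_tree:
  assumes "pair_graph G" and f: "f \<in> parent_maps G r"
    and cyc: "pre_digraph.cycle (with_proj (parent_tree G r f)) p" and len: "3 \<le> length p"
  shows False
proof -
  define T where "T = parent_tree G r f"
  interpret T: pair_graph T unfolding T_def by (rule pair_graph_parent_tree) fact+
  obtain u where u: "T.awalk u p u" "distinct (tl (pawalk_verts u p))" "p \<noteq> []"
    using cyc unfolding T_def[symmetric] T.cycle_def by auto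
  have cas: "pcas u p u" and arcs: "set p \<subseteq> parcs T"
    using u(1) unfolding T.awalk_def by auto
  have "pawalk_verts u p = fst (hd p) # map snd p"
    using T.awalk_verts_conv'[OF cas] u(3) by simp
  then have dist: "distinct (map snd p)" using u(2) by simp
  have closed: "snd (p ! (length p - 1)) = fst (p ! 0)"
  proof -
    have "snd (last p) = u" "fst (hd p) = u"
      using u(1,3) T.awlast_of_awalk[OF u(1)] T.awhd_of_awalk[OF u(1)] T.awalk_verts_conv[of u p]
      by (auto simp: hd_append hd_map simp del: T.awalk_verts_conv)
    then show ?thesis using u(3) by (simp add: last_conv_nth hd_conv_nth)
  qed
  \<comment> \<open>\<open>i\<close> is the position of an arc that ends in a deepest vertex; \<open>h\<close> and \<open>j\<close> are the positions before
     and after it on the cycle\<close>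
  define D where "D i = depth r f (snd (p ! i))" for i
  define n where "n = length p"
  have "Max (D ` {..<n}) \<in> D ` {..<n}"
    by (rule Max_in) (use len in \<open>auto simp: n_def lessThan_empty_iff\<close>)
  then obtain i where i: "i < n" "D i = Max (D ` {..<n})" by auto
  have max: "D j \<le> D i" if "j < n" for j
    unfolding i(2) using that by (intro Max_ge) auto
  define j where "j = (if Suc i < n then Suc i else 0)"
  define h where "h = (if i = 0 then n - 1 else i - 1)"
  have jh: "j < n" "h < n" "j \<noteq> h" using i(1) len by (auto simp: j_def h_def n_def)
  have next_arc: "fst (p ! j) = snd (p ! i)"
    using pcas_nth[OF cas, of i] closed i(1)
    by (cases "Suc i < n") (auto simp: j_def n_def, metis One_nat_def Suc_lessI diff_Suc_1)
  have prev_arc: "snd (p ! h) = fst (p ! i)"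
    using pcas_nth[OF cas, of "i - 1"] closed i(1) by (cases i) (auto simp: h_def n_def)
  have in_T: "(fst (p ! k), snd (p ! k)) \<in> parcs T" if "k < n" for k
    using arcs that by (auto simp: n_def)
  have "fst (p ! i) = f (snd (p ! i))"
    using parent_tree_arc_to_parent[OF f, of "fst (p ! i)" "snd (p ! i)"] in_T[OF i(1)]
      max[OF jh(2)] prev_arc by (simp add: T_def D_def)
  moreover have "snd (p ! j) = f (snd (p ! i))"
    using parent_tree_arc_to_parent[OF f, of "snd (p ! j)" "snd (p ! i)"]
      T.arcs_symmetric[OF in_T[OF jh(1)]] max[OF jh(1)] next_arc by (simp add: T_def D_def)
  ultimately have "snd (p ! h) = snd (p ! j)" using prev_arc by simp
  then show False
    using dist jh by (auto simp: n_def distinct_conv_nth)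
qed

lemma parent_tree_spanning_tree:
  assumes "pair_graph G" and r: "r \<in> pverts G" and f: "f \<in> parent_maps G r"
  shows "parent_tree G r f \<in> undirected_spanning_trees G"
proof -
  interpret G: pair_graph G by fact
  interpret T: pair_graph "parent_tree G r f" by (rule pair_graph_parent_tree) fact+
  have "undirected_tree (with_proj (parent_tree G r f))"
    unfolding undirected_tree_def
    using T.pair_graphD_graph strongly_connected_imp_connected[OF T.pair_graph]
      strongly_connected_parent_tree[OF assms] no_long_cycle_parent_tree[OF assms(1) f] by blast
  moreover have "spanning (with_proj (parent_tree G r f)) (with_proj G)"
    unfolding spanning_def subgraph_def compatible_def
    using parent_tree_subset[OF assms(1) f] G.wf_digraph T.wf_digraph
    by (auto simp: parent_tree_def)
  ultimately show ?thesis unfolding undirected_spanning_trees_def by simp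
qed

text \<open>
  Suppose \<open>f\<close> and \<open>g\<close> yield the same tree and differ at \<open>v\<close>. The edge from \<open>v\<close> to \<open>g v\<close> is then one
  of \<open>f\<close> in the opposite direction, that is \<open>f (g v) = v\<close>. As \<open>g\<close> cannot go back to \<open>v\<close>, the maps
  also differ at \<open>g v\<close>, and so on along the iterates of \<open>g\<close>, which therefore never reach the root.
\<close>
lemma parent_tree_inj:
  assumes r: "r \<in> pverts G" and f: "f \<in> parent_maps G r" and g: "g \<in> parent_maps G r"
    and eq: "parent_tree G r f = parent_tree G r g" and "pair_graph G"
  shows "f = g"
proof
  interpret G: pair_graph G by fact
  fix v
  have arc_cases: "g x = f x \<or> f (g x) = x" if "x \<in> pverts G" "x \<noteq> r" for x
  proof -
    have "(x, g x) \<in> parcs (parent_tree G r f)"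
      unfolding eq using that by (auto simp: parent_tree_def)
    then show ?thesis by (auto simp: parent_tree_def)
  qed
  show "f v = g v"
  proof (cases "v \<in> pverts G \<and> v \<noteq> r")
    case False
    then show ?thesis using parent_mapsD(2,4)[OF f] parent_mapsD(2,4)[OF g] r by metis
  next
    case True
    show ?thesis
    proof (rule ccontr)
      assume "f v \<noteq> g v"
      have run: "(g ^^ k) v \<in> pverts G \<and> (g ^^ k) v \<noteq> r \<and> f (g ((g ^^ k) v)) = (g ^^ k) v" for k
      proof (induction k)
        case 0
        then show ?case using True arc_cases[of v] \<open>f v \<noteq> g v\<close> by auto
      next
        case (Suc k)
        define x where "x = (g ^^ k) v"
        have x: "x \<in> pverts G" "x \<noteq> r" "f (g x) = x" using Suc by (auto simp: x_def)
        have gx: "g x \<in> pverts G" "g x \<noteq> r"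
          using parent_mapsD(1)[OF g x(1,2)] G.in_arcsD2 x parent_mapsD(2)[OF f r] by auto
        have "g (g x) \<noteq> x"
        proof
          assume swap: "g (g x) = x"
          have "(g ^^ l) x \<noteq> r" for l
          proof -
            have "(g ^^ l) x \<in> {x, g x}" by (induction l) (use swap in auto)
            then show ?thesis using x gx by auto
          qed
          then show False using parent_mapsD(3)[OF g x(1)] by blast
        qed
        then show ?case using arc_cases[OF gx] x gx by (auto simp: x_def[symmetric])
      qed
      then show False using parent_mapsD(3)[OF g, of v] True by blast
    qed
  qed
qed

text \<open>
  Sending every vertex to a neighbour closer to \<open>r\<close> in \<open>T\<close> is a parent map whose tree is contained in
  \<open>T\<close>. As this tree already connects all vertices, a further edge of \<open>T\<close> would close a cycle.
\<close>
lemma spanning_tree_parent_tree: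
  assumes "pair_graph G" and r: "r \<in> pverts G" and T: "T \<in> undirected_spanning_trees G"
  shows "\<exists>f\<in>parent_maps G r. T = parent_tree G r f"
proof -
  interpret G: pair_graph G by fact
  have tree: "undirected_tree (with_proj T)" and span: "spanning (with_proj T) (with_proj G)"
    using T by (auto simp: undirected_spanning_trees_def)
  interpret T: pair_graph T
    using tree by (intro pair_graphI_graph) (simp add: undirected_tree_def)
  have verts: "pverts T = pverts G" and arcs: "parcs T \<subseteq> parcs G"
    using span by (auto simp: spanning_def subgraph_def)
  have sc: "strongly_connected (with_proj T)"
    using T.symmetric_connected_imp_strongly_connected[OF T.sym_arcs] tree
    by (simp add: undirected_tree_def)
  define dist where "dist v = (LEAST k. \<exists>p. T.awalk v p r \<and> length p = k)" for v
  have step: "\<exists>w. (v, w) \<in> parcs T \<and> dist w < dist v" if v: "v \<in> pverts G" "v \<noteq> r" for v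
  proof -
    have "\<exists>p. T.awalk v p r"
      using sc v r verts T.reachable_awalk[of v r] by (auto simp: strongly_connected_def)
    then have "\<exists>p. T.awalk v p r \<and> length p = dist v"
      unfolding dist_def using LeastI_ex[of "\<lambda>k. \<exists>p. T.awalk v p r \<and> length p = k"] by blast
    then obtain p where p: "T.awalk v p r" "length p = dist v" by blast
    then obtain e es where es: "p = e # es" using v(2) by (cases p) (auto simp: T.awalk_Nil_iff)
    have w: "(v, snd e) \<in> parcs T" "T.awalk (snd e) es r"
      using p(1) unfolding es T.awalk_Cons_iff by auto
    have "dist (snd e) \<le> length es" unfolding dist_def by (rule Least_le) (use w in auto)
    then show ?thesis using w p(2) es by auto
  qed
  define f where
    "f = (\<lambda>v\<in>pverts G. if v = r then r else SOME w. (v, w) \<in> parcs T \<and> dist w < dist v)"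
  have fr: "f r = r" using r by (simp add: f_def)
  have fv: "(v, f v) \<in> parcs T" "dist (f v) < dist v" if v: "v \<in> pverts G" "v \<noteq> r" for v
    using someI_ex[OF step[OF v]] v by (auto simp: f_def)
  have "\<exists>k. (f ^^ k) v = r" if "v \<in> pverts G" for v
    using that
  proof (induction "dist v" arbitrary: v rule: less_induct)
    case less
    show ?case
    proof (cases "v = r")
      case True
      then have "(f ^^ 0) v = r" by simp
      then show ?thesis by blast
    next
      case False
      then obtain k where "(f ^^ k) (f v) = r"
        using less fv T.in_arcsD2 verts by blast
      then have "(f ^^ Suc k) v = r" by (simp add: funpow_swap1)
      then show ?thesis by blast
    qed
  qed
  moreover have "f \<in> (\<Pi>\<^sub>E v\<in>pverts G. if v = r then {r} else parcs G `` {v})"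
  proof (rule PiE_I)
    show "f v \<in> (if v = r then {r} else parcs G `` {v})" if "v \<in> pverts G" for v
      using that fv(1) fr arcs by auto
    show "f v = undefined" if "v \<notin> pverts G" for v
      using that by (simp add: f_def)
  qed
  ultimately have f: "f \<in> parent_maps G r" by (simp add: parent_maps_def)
  interpret S: pair_graph "parent_tree G r f" by (rule pair_graph_parent_tree) fact+
  have sub: "parcs (parent_tree G r f) \<subseteq> parcs T"
    using fv T.arcs_symmetric by (auto simp: parent_tree_def)
  have "(a, b) \<in> parcs (parent_tree G r f)" if ab: "(a, b) \<in> parcs T" for a b
  proof (rule ccontr)
    assume no: "(a, b) \<notin> parcs (parent_tree G r f)"
    have "a \<noteq> b" using T.pair_no_loops[OF ab] by simp
    obtain p where p: "S.apath b p a"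
      using strongly_connected_parent_tree[OF assms(1) r f] ab T.in_arcsD1 T.in_arcsD2 verts
        S.reachable_apath[of b a] by (auto simp: strongly_connected_def parent_tree_def)
    have awS: "S.awalk b p a" and "distinct (pawalk_verts b p)"
      using p by (auto simp: S.apath_def)
    have "set p \<subseteq> parcs T" "pcas b p a" using awS sub by (auto simp: S.awalk_def)
    then have "T.awalk a ((a, b) # p) a"
      using ab T.in_arcsD1 by (auto simp: T.awalk_def)
    then have "T.cycle ((a, b) # p)"
      using \<open>distinct (pawalk_verts b p)\<close> by (auto simp: T.cycle_def)
    moreover have "2 \<le> length p"
    proof (rule ccontr)
      assume "\<not> 2 \<le> length p"
      then consider "p = []" | e where "p = [e]" by (cases p; cases "tl p") auto
      then show False
      proof cases
        case 1
        then show False using awS \<open>a \<noteq> b\<close> by (auto simp: S.awalk_Nil_iff)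
      next
        case 2
        then have "(b, a) \<in> parcs (parent_tree G r f)"
          using awS by (cases e) (auto simp: S.awalk_Cons_iff S.awalk_Nil_iff)
        then show False using S.arcs_symmetric no by blast
      qed
    qed
    ultimately show False using tree by (fastforce simp: undirected_tree_def)
  qed
  then have "T = parent_tree G r f"
    using sub verts by (intro pair_pre_digraph.equality) (auto simp: parent_tree_def)
  then show ?thesis using f by blast
qed

theorem num_spanning_trees_parent_maps:
  assumes "pair_graph G" "r \<in> pverts G"
  shows "num_spanning_trees G = card (parent_maps G r)"
proof -
  have "bij_betw (parent_tree G r) (parent_maps G r) (undirected_spanning_trees G)"
    unfolding bij_betw_def
    using parent_tree_inj[OF assms(2) _ _ _ assms(1)] parent_tree_spanning_tree[OF assms]
      spanning_tree_parent_tree[OF assms] by (auto simp: inj_on_def image_iff)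
  then show ?thesis by (simp add: num_spanning_trees_def bij_betw_same_card)
qed

section \<open>The matrix-tree theorem\<close>

text \<open>
  The decreasing quantity \<open>d\<close> stands for the distance to the root. A permutation with a nonzero
  contribution sends every index to itself or to its parent, so it does not increase \<open>d\<close> anywhere;
  since it preserves the sum of \<open>d\<close>, it is the identity.
\<close>
lemma det_parent_map_matrix:
  fixes d :: "nat \<Rightarrow> nat" and g :: "nat \<Rightarrow> nat"
  assumes N: "0 < N"
    and dec: "\<And>i. 0 < i \<Longrightarrow> i < N \<Longrightarrow> g i < N \<and> d (g i) < d i"
  shows "det (mat N N (\<lambda>(i, j). if i = 0 \<or> j = 0 then of_bool (i = j)
      else of_bool (i = j) - of_bool (g i = j)) :: real mat) = 1" (is "det ?A = 1")
proof -
  have only_id: "p = id" if p: "p permutes {0..<N}"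
    and nz: "(\<Prod>i = 0..<N. ?A $$ (i, p i)) \<noteq> 0" for p
  proof -
    have lt: "p i < N" if "i < N" for i using p that permutes_in_image[OF p, of i] by simp
    have nzi: "?A $$ (i, p i) \<noteq> 0" if "i < N" for i
      using nz that by (auto simp: prod_zero_iff)
    have le: "d (p i) \<le> d i" and eq: "d (p i) = d i \<Longrightarrow> p i = i" if "i < N" for i
      using nzi[OF that] dec[of i] that lt[OF that]
      by (auto simp: of_bool_def split: if_splits)
    have "(\<Sum>i = 0..<N. d (p i)) = (\<Sum>i = 0..<N. d i)"
      by (rule sum.reindex_bij_betw) (use p permutes_imp_bij in blast)
    then have "d (p i) = d i" if "i < N" for i
      using sum_mono_inv[of "\<lambda>i. d (p i)" "{0..<N}" d i] le that by auto
    then have "p i = i" if "i < N" for i using eq that by auto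
    moreover have "p i = i" if "\<not> i < N" for i using p that by (auto simp: permutes_def)
    ultimately show "p = id" by (auto simp: fun_eq_iff)
  qed
  have "det ?A = (\<Sum>p | p permutes {0..<N}. signof p * (\<Prod>i = 0..<N. ?A $$ (i, p i)))"
    by (rule det_def') auto
  also have "\<dots> = (\<Sum>p\<in>{id}. signof p * (\<Prod>i = 0..<N. ?A $$ (i, p i)))"
  proof (rule sum.mono_neutral_right)
    show "\<forall>p\<in>{p. p permutes {0..<N}} - {id}. signof p * (\<Prod>i = 0..<N. ?A $$ (i, p i)) = 0"
    proof
      fix p assume "p \<in> {p. p permutes {0..<N}} - {id}"
      then have "(\<Prod>i = 0..<N. ?A $$ (i, p i)) = 0" using only_id[of p] by blast
      then show "signof p * (\<Prod>i = 0..<N. ?A $$ (i, p i)) = 0" by (simp only: mult_zero_right)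
    qed
  qed (auto simp: finite_permutations permutes_id)
  also have "\<dots> = 1"
  proof -
    have "?A $$ (i, i) = 1" if "i < N" for i
    proof (cases "i = 0")
      case False
      then have "g i \<noteq> i" using dec[of i] that by auto
      then show ?thesis using that False by simp
    qed (use that in simp)
    then have "(\<Prod>i = 0..<N. ?A $$ (i, i)) = 1" by (intro prod.neutral) simp
    then show ?thesis by simp
  qed
  finally show ?thesis .
qed

text \<open>
  For a map that is not a parent map, \<open>S\<close> is the set of indices that never reach the root; its
  indicator vector is in the kernel of the matrix.
\<close>
lemma det_nonreaching_map_matrix:
  fixes g :: "nat \<Rightarrow> nat"
  assumes inv: "\<And>i. 0 < i \<Longrightarrow> i < N \<Longrightarrow> g i < N \<and> (g i \<in> S \<longleftrightarrow> i \<in> S)"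
    and S: "S \<subseteq> {0<..<N}" "S \<noteq> {}"
  shows "det (mat N N (\<lambda>(i, j). if i = 0 \<or> j = 0 then of_bool (i = j)
      else of_bool (i = j) - of_bool (g i = j)) :: real mat) = 0" (is "det ?A = 0")
proof -
  define x where "x = vec N (\<lambda>i. of_bool (i \<in> S) :: real)"
  have "?A *\<^sub>v x = 0\<^sub>v N"
  proof (rule eq_vecI)
    fix i assume "i < dim_vec (0\<^sub>v N :: real vec)"
    then have i: "i < N" by simp
    have "(?A *\<^sub>v x) $ i = (\<Sum>j = 0..<N. ?A $$ (i, j) * of_bool (j \<in> S))"
      using i by (simp add: x_def scalar_prod_def)
    also have "\<dots> = 0"
    proof (cases "i = 0")
      case True
      then show ?thesis using S by (intro sum.neutral) auto
    next
      case False
      have "(\<Sum>j = 0..<N. ?A $$ (i, j) * of_bool (j \<in> S)) =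
          (\<Sum>j = 0..<N. (if i = j then of_bool (j \<in> S) else 0) -
            (if g i = j then of_bool (j \<in> S) else 0))"
        using False i S by (intro sum.cong) (auto simp: of_bool_def)
      also have "\<dots> = of_bool (i \<in> S) - of_bool (g i \<in> S)"
        using i inv[of i] False by (simp add: sum_subtractf)
      finally show ?thesis using inv[of i] False i by simp
    qed
    finally show "(?A *\<^sub>v x) $ i = 0\<^sub>v N $ i" using i by simp
  qed simp
  moreover have "x \<noteq> 0\<^sub>v N"
  proof
    assume x0: "x = 0\<^sub>v N"
    obtain i where "i \<in> S" using S(2) by blast
    moreover from this have "i < N" using S(1) by auto
    ultimately
    show False using arg_cong[OF x0, of "\<lambda>v. v $ i"] by (simp add: x_def)
  qed
  moreover have "x \<in> carrier_vec N" by (simp add: x_def)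
  ultimately show ?thesis
    using det_0_iff_vec_prod_zero[of ?A N] by auto
qed

text \<open>
  Multilinearity in all rows at once. The choices \<open>f\<close> are indexed by \<open>V\<close> and not by the row numbers, so
  that for the vertices of a graph they can be compared with parent maps.
\<close>
lemma det_sum_rows:
  fixes B :: "nat \<Rightarrow> 'b \<Rightarrow> nat \<Rightarrow> real"
  assumes e: "bij_betw e {0..<N} V" and fin: "\<And>v. v \<in> V \<Longrightarrow> finite (K v)" and V: "finite V"
  shows "det (mat N N (\<lambda>(i, j). \<Sum>u\<in>K (e i). B i u j)) =
    (\<Sum>f\<in>(\<Pi>\<^sub>E v\<in>V. K v). det (mat N N (\<lambda>(i, j). B i (f (e i)) j)))"
proof -
  define e' where "e' = the_inv_into {0..<N} e"
  have e': "e' (e i) = i" if "i < N" for i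
    using e that by (simp add: e'_def bij_betw_def the_inv_into_f_f)
  have expand: "(\<Prod>i = 0..<N. \<Sum>u\<in>K (e i). B i u (p i)) =
      (\<Sum>f\<in>(\<Pi>\<^sub>E v\<in>V. K v). \<Prod>i = 0..<N. B i (f (e i)) (p i))" for p
  proof -
    have "(\<Prod>i = 0..<N. \<Sum>u\<in>K (e i). B i u (p i)) =
        (\<Prod>i = 0..<N. (\<lambda>v. \<Sum>u\<in>K v. B (e' v) u (p (e' v))) (e i))"
      by (rule prod.cong) (simp_all add: e')
    also have "\<dots> = (\<Prod>v\<in>V. \<Sum>u\<in>K v. B (e' v) u (p (e' v)))"
      by (rule prod.reindex_bij_betw[OF e])
    also have "\<dots> = (\<Sum>f\<in>(\<Pi>\<^sub>E v\<in>V. K v). \<Prod>v\<in>V. B (e' v) (f v) (p (e' v)))"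
      by (rule prod_sum_PiE) (use V fin in auto)
    also have "\<dots> = (\<Sum>f\<in>(\<Pi>\<^sub>E v\<in>V. K v). \<Prod>i = 0..<N. B i (f (e i)) (p i))"
    proof (rule sum.cong[OF refl])
      fix f
      have "(\<Prod>v\<in>V. B (e' v) (f v) (p (e' v))) =
          (\<Prod>i = 0..<N. (\<lambda>v. B (e' v) (f v) (p (e' v))) (e i))"
        by (rule prod.reindex_bij_betw[OF e, symmetric])
      also have "\<dots> = (\<Prod>i = 0..<N. B i (f (e i)) (p i))"
        by (rule prod.cong) (simp_all add: e')
      finally show "(\<Prod>v\<in>V. B (e' v) (f v) (p (e' v))) = (\<Prod>i = 0..<N. B i (f (e i)) (p i))" .
    qed
    finally show ?thesis .
  qed
  have lt: "p i < N" if "p permutes {0..<N}" "i < N" for p i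
    using that permutes_in_image[of p "{0..<N}" i] by simp
  have "det (mat N N (\<lambda>(i, j). \<Sum>u\<in>K (e i). B i u j)) =
      (\<Sum>p | p permutes {0..<N}. signof p * (\<Prod>i = 0..<N. \<Sum>u\<in>K (e i). B i u (p i)))"
    by (subst det_def'[of _ N]) (auto intro!: sum.cong prod.cong simp: lt)
  also have "\<dots> = (\<Sum>p | p permutes {0..<N}. \<Sum>f\<in>(\<Pi>\<^sub>E v\<in>V. K v).
      signof p * (\<Prod>i = 0..<N. B i (f (e i)) (p i)))"
    by (simp only: expand sum_distrib_left)
  also have "\<dots> = (\<Sum>f\<in>(\<Pi>\<^sub>E v\<in>V. K v). \<Sum>p | p permutes {0..<N}.
      signof p * (\<Prod>i = 0..<N. B i (f (e i)) (p i)))"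
    by (rule sum.swap)
  also have "\<dots> = (\<Sum>f\<in>(\<Pi>\<^sub>E v\<in>V. K v). det (mat N N (\<lambda>(i, j). B i (f (e i)) j)))"
    by (rule sum.cong[OF refl], subst det_def'[of _ N]) (auto intro!: sum.cong prod.cong simp: lt)
  finally show ?thesis .
qed

definition laplacian :: "'a pair_pre_digraph \<Rightarrow> 'a \<Rightarrow> 'a \<Rightarrow> real" where
  "laplacian G v w =
     (if v = w then real (card (parcs G `` {v})) else - of_bool ((v, w) \<in> parcs G))"

text \<open>
  The classical form: the reduced Laplacian, here not with row and column \<open>0\<close> deleted, but with both
  replaced by those of the identity matrix. Row \<open>i > 0\<close> is a sum of one row for each neighbour of \<open>e i\<close>, so
  that the expansion runs over all choices of a neighbour for each vertex.
\<close>
lemma det_reduced_laplacian: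
  assumes "pair_graph G" and e: "bij_betw e {0..<N} (pverts G)" and N: "0 < N"
  shows "det (mat N N (\<lambda>(i, j). if i = 0 \<or> j = 0 then of_bool (i = j)
      else laplacian G (e i) (e j))) = real (num_spanning_trees G)" (is "det ?L = _")
proof -
  interpret G: pair_graph G by fact
  define r where "r = e 0"
  have ein: "e i \<in> pverts G" if "i < N" for i using e that by (auto simp: bij_betw_def)
  have einj: "e i = e j \<longleftrightarrow> i = j" if "i < N" "j < N" for i j
    using e that by (auto simp: bij_betw_def inj_on_def)
  have r: "r \<in> pverts G" unfolding r_def using ein N by simp
  define K where "K v = (if v = r then {r} else parcs G `` {v})" for v
  have finN: "finite (parcs G `` {v})" for v
    using G.pair_finite_arcs by (rule finite_Image)
  define B where "B i u j = (if i = 0 \<or> j = 0 then of_bool (i = j)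
      else of_bool (i = j) - of_bool (u = e j) :: real)" for i u j
  have "?L = mat N N (\<lambda>(i, j). \<Sum>u\<in>K (e i). B i u j)"
  proof (rule cong_mat[OF refl refl], clarify)
    fix i j assume i: "i < N" and j: "j < N"
    have "(\<Sum>u\<in>parcs G `` {e i}. of_bool (i = j) - of_bool (u = e j) :: real) =
        real (card (parcs G `` {e i})) * of_bool (i = j) - of_bool ((e i, e j) \<in> parcs G)"
      using finN by (simp add: sum_subtractf of_bool_def)
    moreover have "(e i, e i) \<notin> parcs G" using G.pair_no_loops by fastforce
    moreover have "e i = r \<longleftrightarrow> i = 0" using einj[OF i N] by (simp add: r_def)
    moreover have "(\<Sum>u\<in>parcs G `` {e i}. B i u 0) = 0" if "i \<noteq> 0"
      using that by (simp add: B_def)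
    ultimately show "(if i = 0 \<or> j = 0 then of_bool (i = j) else laplacian G (e i) (e j)) =
        (\<Sum>u\<in>K (e i). B i u j)"
      using einj[OF i j] by (auto simp: K_def B_def laplacian_def)
  qed
  also have "det \<dots> = (\<Sum>f\<in>(\<Pi>\<^sub>E v\<in>pverts G. K v). det (mat N N (\<lambda>(i, j). B i (f (e i)) j)))"
    by (rule det_sum_rows[OF e]) (use finN G.pair_finite_verts in \<open>auto simp: K_def\<close>)
  also have "\<dots> = (\<Sum>f\<in>(\<Pi>\<^sub>E v\<in>pverts G. K v). of_bool (f \<in> parent_maps G r))"
  proof (rule sum.cong[OF refl])
    fix f assume f: "f \<in> (\<Pi>\<^sub>E v\<in>pverts G. K v)"
    define g where "g i = the_inv_into {0..<N} e (f (e i))" for i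
    have fin: "f v \<in> pverts G" if "v \<in> pverts G" for v
      using PiE_mem[OF f that] r G.in_arcsD2 by (auto simp: K_def split: if_splits)
    have fr: "f r = r" using PiE_mem[OF f r] by (simp add: K_def)
    have g: "g i < N" "e (g i) = f (e i)" if "i < N" for i
    proof -
      show "e (g i) = f (e i)" unfolding g_def
        using e fin[OF ein[OF that]] by (simp add: f_the_inv_into_f_bij_betw)
      show "g i < N" unfolding g_def
        using e fin[OF ein[OF that]] the_inv_into_into[of e "{0..<N}" "f (e i)" "{0..<N}"]
        by (auto simp: bij_betw_def)
    qed
    have mat_eq: "mat N N (\<lambda>(i, j). B i (f (e i)) j) =
        mat N N (\<lambda>(i, j). if i = 0 \<or> j = 0 then of_bool (i = j)
          else of_bool (i = j) - of_bool (g i = j))"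
      by (rule cong_mat[OF refl refl]) (auto simp: B_def einj g simp flip: g(2))
    show "det (mat N N (\<lambda>(i, j). B i (f (e i)) j)) = of_bool (f \<in> parent_maps G r)"
    proof (cases "f \<in> parent_maps G r")
      case True
      have "det (mat N N (\<lambda>(i, j). B i (f (e i)) j)) = 1" unfolding mat_eq
      proof (rule det_parent_map_matrix[OF N, where d = "\<lambda>i. depth r f (e i)"])
        fix i assume i: "0 < i" "i < N"
        then have "e i \<noteq> r" using einj[of i 0] N by (auto simp: r_def)
        then show "g i < N \<and> depth r f (e (g i)) < depth r f (e i)"
          using depth_parent_maps[OF True ein[OF i(2)]] g[OF i(2)] by simp
      qed
      then show ?thesis using True by simp
    next
      case False
      define S where "S = {i. i < N \<and> (\<forall>k. (f ^^ k) (e i) \<noteq> r)}"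
      have "det (mat N N (\<lambda>(i, j). B i (f (e i)) j)) = 0" unfolding mat_eq
      proof (rule det_nonreaching_map_matrix[where S = S])
        have "(f ^^ 0) (e 0) = r" by (simp add: r_def)
        then have "0 \<notin> S" unfolding S_def by blast
        then show "S \<subseteq> {0<..<N}" by (auto simp: S_def intro!: Nat.gr0I)
        have "\<exists>v\<in>pverts G. \<forall>k. (f ^^ k) v \<noteq> r"
          using False f by (auto simp: parent_maps_def K_def)
        then show "S \<noteq> {}" using e by (force simp: S_def bij_betw_def)
        fix i assume i: "0 < i" "i < N"
        then have ne: "e i \<noteq> r" using einj[of i 0] N by (auto simp: r_def)
        have "(\<exists>k. (f ^^ k) (e i) = r) \<longleftrightarrow> (\<exists>k. (f ^^ k) (f (e i)) = r)"
        proof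
          assume "\<exists>k. (f ^^ k) (e i) = r"
          then obtain k where k: "(f ^^ k) (e i) = r" by blast
          then obtain l where "k = Suc l" using ne by (cases k) auto
          then show "\<exists>k. (f ^^ k) (f (e i)) = r" using k by (auto simp: funpow_swap1)
        next
          assume "\<exists>k. (f ^^ k) (f (e i)) = r"
          then obtain k where "(f ^^ Suc k) (e i) = r" by (auto simp: funpow_swap1)
          then show "\<exists>k. (f ^^ k) (e i) = r" by blast
        qed
        then show "g i < N \<and> (g i \<in> S \<longleftrightarrow> i \<in> S)"
          using g[OF i(2)] i by (auto simp: S_def)
      qed
      then show ?thesis using False by simp
    qed
  qed
  also have "\<dots> = real (card (parent_maps G r))"
  proof -
    have "finite (\<Pi>\<^sub>E v\<in>pverts G. K v)"
      using finN G.pair_finite_verts by (intro finite_PiE) (auto simp: K_def)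
    moreover have "parent_maps G r \<subseteq> (\<Pi>\<^sub>E v\<in>pverts G. K v)"
      by (auto simp: parent_maps_def K_def)
    ultimately show ?thesis by (simp add: sum.If_cases of_bool_def Int_absorb1)
  qed
  also have "\<dots> = real (num_spanning_trees G)"
    using num_spanning_trees_parent_maps[OF assms(1) r] by simp
  finally show ?thesis .
qed

text \<open>Both sides are computed by expansion along column \<open>0\<close>, with the same minor.\<close>
lemma det_column_cleared:
  fixes A :: "real mat"
  assumes A: "A \<in> carrier_mat N N" and N: "0 < N"
    and col: "\<And>i. 0 < i \<Longrightarrow> i < N \<Longrightarrow> A $$ (i, 0) = 0"
  shows "det A = A $$ (0, 0) * det (mat N N (\<lambda>(i, j). if i = 0 \<or> j = 0 then of_bool (i = j)
      else A $$ (i, j)))" (is "_ = _ * det ?R")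
proof -
  have "det A = (\<Sum>i<N. A $$ (i, 0) * cofactor A i 0)"
    by (rule laplace_expansion_column[OF A N])
  also have "\<dots> = (\<Sum>i\<in>{0}. A $$ (i, 0) * cofactor A i 0)"
    by (rule sum.mono_neutral_right) (use N col in auto)
  finally have 1: "det A = A $$ (0, 0) * cofactor A 0 0" by simp
  have "det ?R = (\<Sum>i<N. ?R $$ (i, 0) * cofactor ?R i 0)"
    by (rule laplace_expansion_column[OF _ N]) simp
  also have "\<dots> = (\<Sum>i\<in>{0}. ?R $$ (i, 0) * cofactor ?R i 0)"
    by (rule sum.mono_neutral_right) (use N in auto)
  finally have 2: "det ?R = cofactor ?R 0 0" using N by simp
  have "mat_delete A 0 0 = mat_delete ?R 0 0"
    using A by (intro eq_matI) (auto simp: mat_delete_def)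
  then show ?thesis unfolding 1 2 by (simp add: cofactor_def)
qed

lemma laplacian_row_sum:
  assumes "pair_graph G" and v: "v \<in> pverts G"
  shows "(\<Sum>w\<in>pverts G. laplacian G v w) = 0"
proof -
  interpret G: pair_graph G by fact
  have loop: "(v, v) \<notin> parcs G" using G.pair_no_loops by fastforce
  have "(\<Sum>w\<in>pverts G. laplacian G v w) =
      (\<Sum>w\<in>pverts G. (if w = v then real (card (parcs G `` {v})) else 0) -
        of_bool ((v, w) \<in> parcs G))"
    by (rule sum.cong) (use loop in \<open>auto simp: laplacian_def\<close>)
  also have "\<dots> = real (card (parcs G `` {v})) - (\<Sum>w\<in>pverts G. of_bool ((v, w) \<in> parcs G))"
    using v G.pair_finite_verts by (simp add: sum_subtractf)
  also have "(\<Sum>w\<in>pverts G. of_bool ((v, w) \<in> parcs G)) = real (card (parcs G `` {v}))"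
  proof -
    have "pverts G \<inter> {w. (v, w) \<in> parcs G} = parcs G `` {v}"
      using G.in_arcsD2 by auto
    then show ?thesis using G.pair_finite_verts by (simp add: of_bool_def sum.If_cases)
  qed
  finally show ?thesis by simp
qed

text \<open>
  Adding all columns to column \<open>0\<close> replaces it by the row sums, which vanish except in row \<open>0\<close>. This
  leaves the reduced Laplacian, whatever the other entries of row \<open>0\<close> are.
\<close>
theorem matrix_tree:
  assumes "pair_graph G" and e: "bij_betw e {0..<N} (pverts G)" and N: "0 < N"
  shows "det (mat N N (\<lambda>(i, j). laplacian G (e i) (e j) + (if i = 0 then x j else 0))) =
    (\<Sum>j = 0..<N. x j) * real (num_spanning_trees G)" (is "det ?M = _")
proof -
  \<comment> \<open>multiplication by \<open>Q\<close> from the right adds all columns to column \<open>0\<close>\<close>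
  define Q where "Q = mat N N (\<lambda>(i, j). of_bool (i = j \<or> j = 0) :: real)"
  have M: "?M \<in> carrier_mat N N" and Q: "Q \<in> carrier_mat N N" by (simp_all add: Q_def)
  have "det Q = prod_list (diag_mat Q)"
    by (rule det_lower_triangular[OF _ Q]) (auto simp: Q_def)
  also have "diag_mat Q = map (\<lambda>_. 1) [0..<N]" by (auto simp: diag_mat_def Q_def)
  finally have detQ: "det Q = 1" by (simp add: map_replicate_const)
  have rowsum: "(\<Sum>k = 0..<N. ?M $$ (i, k)) = (if i = 0 then \<Sum>j = 0..<N. x j else 0)"
    if i: "i < N" for i
  proof -
    have "e i \<in> pverts G" using e i by (auto simp: bij_betw_def)
    then have "(\<Sum>k = 0..<N. laplacian G (e i) (e k)) = 0"
      using sum.reindex_bij_betw[OF e, of "laplacian G (e i)"] laplacian_row_sum[OF assms(1)]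
      by simp
    then show ?thesis using i by (simp add: sum.distrib)
  qed
  define R where "R = ?M * Q"
  have R: "R \<in> carrier_mat N N" unfolding R_def by (rule mult_carrier_mat[OF M Q])
  have R_entry: "R $$ (i, j) =
      (if j = 0 then (if i = 0 then \<Sum>j = 0..<N. x j else 0) else ?M $$ (i, j))"
    if "i < N" "j < N" for i j
  proof -
    have "R $$ (i, j) = (\<Sum>k = 0..<N. ?M $$ (i, k) * of_bool (k = j \<or> j = 0))"
      using that by (simp add: R_def Q_def scalar_prod_def)
    also have "\<dots> = (if j = 0 then (\<Sum>k = 0..<N. ?M $$ (i, k)) else ?M $$ (i, j))"
    proof (cases "j = 0")
      case False
      have "(\<Sum>k = 0..<N. ?M $$ (i, k) * of_bool (k = j \<or> j = 0)) =
          (\<Sum>k = 0..<N. if k = j then ?M $$ (i, k) else 0)"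
        using False by (intro sum.cong) simp_all
      then show ?thesis using that False by simp
    qed simp
    finally show ?thesis using rowsum[OF that(1)] by simp
  qed
  have "det ?M = det R" using det_mult[OF M Q] detQ by (simp add: R_def)
  also have "\<dots> = R $$ (0, 0) * det (mat N N (\<lambda>(i, j). if i = 0 \<or> j = 0 then of_bool (i = j)
      else R $$ (i, j)))"
    by (rule det_column_cleared[OF _ N]) (use R R_entry N in auto)
  also have "mat N N (\<lambda>(i, j). if i = 0 \<or> j = 0 then of_bool (i = j) else R $$ (i, j)) =
      mat N N (\<lambda>(i, j). if i = 0 \<or> j = 0 then of_bool (i = j) else laplacian G (e i) (e j))"
    by (rule cong_mat[OF refl refl]) (auto simp: R_entry)
  also have "det \<dots> = real (num_spanning_trees G)"
    by (rule det_reduced_laplacian[OF assms(1) e N])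
  also have "R $$ (0, 0) = (\<Sum>j = 0..<N. x j)" using R_entry[OF N N] by simp
  finally show ?thesis .
qed

section \<open>Determinants of matrices with a block symmetry\<close>

text \<open>
  Adding the lower block row to the upper one makes the two upper blocks equal; subtracting the left
  block column from the right one then clears the upper right block.
\<close>
lemma det_folded_blocks:
  fixes f :: "nat \<Rightarrow> nat \<Rightarrow> real"
  assumes fold: "\<And>i j. i < n \<Longrightarrow> j < n \<Longrightarrow> f i j + f (i + n) j = f i (j + n) + f (i + n) (j + n)"
  shows "det (mat (n + n) (n + n) (\<lambda>(i, j). f i j)) =
    det (mat n n (\<lambda>(i, j). f i j + f (i + n) j)) *
    det (mat n n (\<lambda>(i, j). f (i + n) (j + n) - f (i + n) j))"
    (is "det ?M = det ?S * det ?D")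
proof -
  define A B C D where "A = mat n n (\<lambda>(i, j). f i j)" and "B = mat n n (\<lambda>(i, j). f i (j + n))"
    and "C = mat n n (\<lambda>(i, j). f (i + n) j)" and "D = mat n n (\<lambda>(i, j). f (i + n) (j + n))"
  have carr: "A \<in> carrier_mat n n" "B \<in> carrier_mat n n" "C \<in> carrier_mat n n" "D \<in> carrier_mat n n"
    by (simp_all add: A_def B_def C_def D_def)
  define I Z where "I = (1\<^sub>m n :: real mat)" and "Z = (0\<^sub>m n n :: real mat)"
  have IZ: "I \<in> carrier_mat n n" "Z \<in> carrier_mat n n" "- I \<in> carrier_mat n n"
    by (simp_all add: I_def Z_def)
  have M: "?M = four_block_mat A B C D"
    by (rule eq_matI) (auto simp: A_def B_def C_def D_def)
  define P Q where "P = four_block_mat I I Z I" and "Q = four_block_mat I (- I) Z I"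
  have PQ: "P \<in> carrier_mat (n + n) (n + n)" "Q \<in> carrier_mat (n + n) (n + n)"
    using IZ by (simp_all add: P_def Q_def)
  have detI: "det I = 1" by (simp add: I_def)
  have detP: "det P = 1" and detQ: "det Q = 1"
    unfolding P_def Q_def
    by (subst det_four_block_mat_lower_left_zero[of _ n _ n]; use IZ detI in \<open>simp add: Z_def\<close>)+
  have PM: "P * ?M = four_block_mat (A + C) (B + D) C D"
  proof -
    have "P * ?M = four_block_mat (I * A + I * C) (I * B + I * D) (Z * A + I * C) (Z * B + I * D)"
      unfolding P_def M by (rule mult_four_block_mat[OF IZ(1,1,2,1) carr])
    then show ?thesis using carr by (simp add: I_def Z_def)
  qed
  have fold_mat: "(A + C) * (- I) + (B + D) * I = Z"
    using carr fold by (intro eq_matI) (auto simp: A_def B_def C_def D_def I_def Z_def)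
  have diff_mat: "C * (- I) + D * I = ?D"
    using carr by (intro eq_matI) (auto simp: C_def D_def I_def)
  have "P * ?M * Q = four_block_mat ((A + C) * I + (B + D) * Z) ((A + C) * (- I) + (B + D) * I)
      (C * I + D * Z) (C * (- I) + D * I)"
    unfolding PM Q_def by (rule mult_four_block_mat[OF _ _ _ _ IZ(1,3,2,1)]) (use carr in auto)
  also have "\<dots> = four_block_mat (A + C) Z C ?D"
    unfolding fold_mat diff_mat using carr by (simp add: I_def Z_def)
  also have "A + C = ?S" by (rule eq_matI) (auto simp: A_def C_def)
  finally have PMQ: "P * ?M * Q = four_block_mat ?S Z C ?D" .
  have "det ?M = det (P * ?M * Q)"
    using PQ detP detQ det_mult[of "P * ?M" "n + n" Q] det_mult[of P "n + n" ?M] by simp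
  also have "\<dots> = det ?S * det ?D"
    unfolding PMQ
    by (rule det_four_block_mat_upper_right_zero[of _ n _ n]) (use carr in \<open>simp_all add: Z_def\<close>)
  finally show ?thesis .
qed

lemma det_diagonal:
  fixes g :: "nat \<Rightarrow> real"
  shows "det (mat n n (\<lambda>(i, j). if i = j then g i else 0)) = (\<Prod>i = 0..<n. g i)"
  by (subst det_upper_triangular[of _ n]) (auto simp: prod_list_diag_prod intro!: prod.cong)

section \<open>Spanning trees of a strong prism\<close>

text \<open>
  In this form the dependence on the two layers is isolated in one diagonal term of varying sign, which
  cancels in the sum of the blocks and doubles in their difference.
\<close>
lemma laplacian_strong_prism:
  assumes "pair_graph G" "v \<in> pverts G" "w \<in> pverts G"
  shows "laplacian (strong_prism G) (v, b) (w, c) =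
    laplacian G v w +
      (if v = w then (if b = c then 1 else - 1) * (real (card (parcs G `` {v})) + 1) else 0)"
proof -
  interpret G: pair_graph G by fact
  have loop: "(v, v) \<notin> parcs G" using G.pair_no_loops by fastforce
  have "parcs (strong_prism G) `` {(v, b)} = (insert v (parcs G `` {v}) \<times> UNIV) - {(v, b)}"
    for b
    using assms(2) G.in_arcsD2 by (auto simp: strong_prism_def strong_product_def K2_def)
  moreover have "finite (parcs G `` {v})" using G.pair_finite_arcs by (rule finite_Image)
  ultimately have deg: "card (parcs (strong_prism G) `` {(v, b)}) = 2 * card (parcs G `` {v}) + 1"
    for b
    using loop by (simp add: card_cartesian_product)
  have "((v, b), (w, c)) \<in> parcs (strong_prism G) \<longleftrightarrow>
      (v, b) \<noteq> (w, c) \<and> (v = w \<or> (v, w) \<in> parcs G)"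
    using assms(2,3) by (auto simp: strong_prism_def strong_product_def K2_def)
  then show ?thesis using deg[of b] loop by (auto simp: laplacian_def)
qed

text \<open>
  The factor \<open>4\<close> on the left is the sum of the perturbation, which is \<open>2\<close> at both twins of the root.
  The value \<open>2\<close> lets the sum of the blocks be exactly twice a rooted Laplacian of \<open>G\<close>.
\<close>
theorem num_spanning_trees_strong_prism:
  assumes "pair_graph G" "pverts G \<noteq> {}"
  shows "4 * real (num_spanning_trees (strong_prism G)) =
    4 ^ card (pverts G) * (\<Prod>v\<in>pverts G. real (card (parcs G `` {v})) + 1) *
    real (num_spanning_trees G)"
proof -
  interpret G: pair_graph G by fact
  define N where "N = card (pverts G)"
  have N: "0 < N" using assms(2) G.pair_finite_verts by (simp add: N_def card_gt_0_iff)
  obtain e where e: "bij_betw e {0..<N} (pverts G)"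
    using ex_bij_betw_nat_finite[OF G.pair_finite_verts] by (auto simp: N_def)
  have ein: "e i \<in> pverts G" if "i < N" for i using e that by (auto simp: bij_betw_def)
  have einj: "e i = e j \<longleftrightarrow> i = j" if "i < N" "j < N" for i j
    using e that by (auto simp: bij_betw_def inj_on_def)
  define e2 where "e2 k = (if k < N then (e k, False) else (e (k - N), True))" for k
  have e2: "bij_betw e2 {0..<N + N} (pverts (strong_prism G))"
  proof (rule bij_betwI')
    show "(e2 x = e2 y) = (x = y)" if "x \<in> {0..<N + N}" "y \<in> {0..<N + N}" for x y
      using that by (auto simp: e2_def einj)
    show "e2 x \<in> pverts (strong_prism G)" if "x \<in> {0..<N + N}" for x
      using that by (auto simp: e2_def ein strong_prism_def strong_product_def K2_def)
    show "\<exists>x\<in>{0..<N + N}. y = e2 x" if y: "y \<in> pverts (strong_prism G)" for y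
    proof -
      obtain v b where vb: "y = (v, b)" "v \<in> pverts G"
        using y by (auto simp: strong_prism_def strong_product_def)
      moreover have "v \<in> e ` {0..<N}" using vb(2) e by (simp add: bij_betw_def)
      ultimately obtain i where "i < N" "v = e i" by auto
      then have "y = e2 (if b then i + N else i)" "(if b then i + N else i) \<in> {0..<N + N}"
        using vb by (auto simp: e2_def)
      then show ?thesis by blast
    qed
  qed
  define g where "g i = real (card (parcs G `` {e i})) + 1" for i
  define x where "x j = (2 * of_bool (j = 0 \<or> j = N) :: real)" for j
  define f where "f i j = laplacian (strong_prism G) (e2 i) (e2 j) + (if i = 0 then x j else 0)" for i j
  have f: "f i j = laplacian G (e i) (e j) + (if i = j then g i else 0) +
        (if i = 0 \<and> j = 0 then 2 else 0)"
      "f i (j + N) = laplacian G (e i) (e j) - (if i = j then g i else 0) +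
        (if i = 0 \<and> j = 0 then 2 else 0)"
      "f (i + N) j = laplacian G (e i) (e j) - (if i = j then g i else 0)"
      "f (i + N) (j + N) = laplacian G (e i) (e j) + (if i = j then g i else 0)"
    if "i < N" "j < N" for i j
    using that N
    by (auto simp: f_def e2_def laplacian_strong_prism[OF assms(1)] ein einj g_def x_def)
  have "(\<Sum>j = 0..<N + N. x j) = (\<Sum>j\<in>{0, N}. x j)"
    by (rule sum.mono_neutral_right) (use N in \<open>auto simp: x_def\<close>)
  then have xsum: "(\<Sum>j = 0..<N + N. x j) = 4" using N by (simp add: x_def)
  have "4 * real (num_spanning_trees (strong_prism G)) = det (mat (N + N) (N + N) (\<lambda>(i, j). f i j))"
    unfolding f_def
    using matrix_tree[OF pair_graph_strong_prism[OF assms(1)] e2, of x] N xsum by simp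
  also have "\<dots> = det (mat N N (\<lambda>(i, j). f i j + f (i + N) j)) *
      det (mat N N (\<lambda>(i, j). f (i + N) (j + N) - f (i + N) j))"
    by (rule det_folded_blocks) (simp add: f)
  also have "mat N N (\<lambda>(i, j). f i j + f (i + N) j) =
      2 \<cdot>\<^sub>m mat N N (\<lambda>(i, j). laplacian G (e i) (e j) + (if i = 0 then of_bool (j = 0) else 0))"
    by (rule eq_matI) (auto simp: f)
  also have "det \<dots> = 2 ^ N * real (num_spanning_trees G)"
  proof -
    have "(\<Sum>j::nat = 0..<N. of_bool (j = 0) :: real) = (\<Sum>j\<in>{0::nat}. of_bool (j = 0))"
      by (rule sum.mono_neutral_right) (use N in auto)
    then show ?thesis
      using matrix_tree[OF assms(1) e N, of "\<lambda>j. of_bool (j = 0)"] by simp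
  qed
  also have "mat N N (\<lambda>(i, j). f (i + N) (j + N) - f (i + N) j) =
      mat N N (\<lambda>(i, j). if i = j then 2 * g i else 0)"
    by (rule eq_matI) (auto simp: f)
  also have "det \<dots> = 2 ^ N * (\<Prod>v\<in>pverts G. real (card (parcs G `` {v})) + 1)"
    using prod.reindex_bij_betw[OF e, of "\<lambda>v. real (card (parcs G `` {v})) + 1", folded g_def]
    by (simp add: det_diagonal prod.distrib)
  finally show ?thesis by (simp add: N_def power_mult_distrib flip: power_mult_distrib)
qed

section \<open>Tridiagonal determinants and the path\<close>

text \<open>Expansion along the last row, and then of the one minor that is not a leading one along its last
  column.\<close>
lemma det_tridiagonal:
  fixes f :: "nat \<Rightarrow> nat \<Rightarrow> real"
  assumes tri: "\<And>i j. Suc i < j \<or> Suc j < i \<Longrightarrow> f i j = 0"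
  shows "det (mat (k + 2) (k + 2) (\<lambda>(i, j). f i j)) =
    f (k + 1) (k + 1) * det (mat (k + 1) (k + 1) (\<lambda>(i, j). f i j)) -
    f (k + 1) k * f k (k + 1) * det (mat k k (\<lambda>(i, j). f i j))" (is "det ?A = _")
proof -
  define B where "B = mat_delete ?A (k + 1) k"
  have B: "B \<in> carrier_mat (k + 1) (k + 1)" by (simp add: B_def mat_delete_def)
  have Bk: "B $$ (i, k) = (if i = k then f k (k + 1) else 0)" if "i < k + 1" for i
    using that by (auto simp: B_def mat_delete_def tri)
  have "det ?A = (\<Sum>j<k + 2. ?A $$ (k + 1, j) * cofactor ?A (k + 1) j)"
    by (rule laplace_expansion_row) auto
  also have "\<dots> = (\<Sum>j\<in>{k, k + 1}. ?A $$ (k + 1, j) * cofactor ?A (k + 1) j)"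
    by (rule sum.mono_neutral_right) (auto simp: tri)
  also have "\<dots> = f (k + 1) k * cofactor ?A (k + 1) k + f (k + 1) (k + 1) * cofactor ?A (k + 1) (k + 1)"
    by simp
  also have "cofactor ?A (k + 1) (k + 1) = det (mat (k + 1) (k + 1) (\<lambda>(i, j). f i j))"
    unfolding cofactor_def
    by (simp, rule arg_cong[where f = det], rule eq_matI) (auto simp: mat_delete_def)
  also have "cofactor ?A (k + 1) k = - det B" by (simp add: cofactor_def B_def)
  also have "det B = (\<Sum>i<k + 1. B $$ (i, k) * cofactor B i k)"
    by (rule laplace_expansion_column[OF B]) simp
  also have "\<dots> = (\<Sum>i\<in>{k}. B $$ (i, k) * cofactor B i k)"
    by (rule sum.mono_neutral_right) (auto simp: Bk)
  also have "\<dots> = f k (k + 1) * cofactor B k k" by (simp add: Bk)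
  also have "cofactor B k k = det (mat k k (\<lambda>(i, j). f i j))"
    unfolding cofactor_def
    by (simp, rule arg_cong[where f = det], rule eq_matI) (auto simp: mat_delete_def B_def)
  finally show ?thesis by simp
qed

text \<open>The bound \<open>M\<close> allows matrices whose last diagonal entry breaks the pattern of the others, as it
  does for the end of a path.\<close>
lemma det_tridiagonal_recurrence:
  fixes f :: "nat \<Rightarrow> nat \<Rightarrow> real"
  assumes tri: "\<And>i j. Suc i < j \<or> Suc j < i \<Longrightarrow> f i j = 0"
    and D0: "D 0 = 1" and D1: "D 1 = f 0 0"
    and step: "\<And>k. k + 2 \<le> M \<Longrightarrow>
      D (k + 2) = f (k + 1) (k + 1) * D (k + 1) - f (k + 1) k * f k (k + 1) * D k"
    and "k \<le> M"
  shows "det (mat k k (\<lambda>(i, j). f i j)) = D k"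
  using \<open>k \<le> M\<close>
proof (induction k rule: less_induct)
  case (less k)
  consider "k = 0" | "k = 1" | l where "k = l + 2"
    by (metis One_nat_def Suc_1 add_2_eq_Suc' not0_implies_Suc)
  then show ?case
  proof cases
    case 1
    then show ?thesis using D0 by simp
  next
    case 2
    then show ?thesis using D1 by (simp add: det_single)
  next
    case (3 l)
    then show ?thesis
      using less det_tridiagonal[of f l, OF tri] step[of l] by simp
  qed
qed

text \<open>The path has the vertices \<open>0, \<dots>, n\<close>.\<close>
definition path_laplacian :: "nat \<Rightarrow> nat \<Rightarrow> nat \<Rightarrow> real" where
  "path_laplacian n i j =
     (if i = j then of_bool (0 < i) + of_bool (i < n) else - of_bool (j = Suc i \<or> i = Suc j))"

text \<open>The leading minor of size \<open>k\<close> is \<open>k + 1\<close> as long as \<open>k \<le> n\<close>; the smaller last diagonal entry then brings the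
  value back to \<open>1\<close>, the number of spanning trees of a path.\<close>
lemma det_path_laplacian_rooted:
  assumes "1 \<le> n"
  shows "det (mat (Suc n) (Suc n) (\<lambda>(i, j). path_laplacian n i j + of_bool (i = 0 \<and> j = 0))) = 1"
proof -
  define D where "D k = (if k \<le> n then real k + 1 else 1)" for k
  have "det (mat (Suc n) (Suc n) (\<lambda>(i, j). path_laplacian n i j + of_bool (i = 0 \<and> j = 0))) =
      D (Suc n)"
    by (rule det_tridiagonal_recurrence[where M = "Suc n"])
      (use assms in \<open>auto simp: D_def path_laplacian_def algebra_simps\<close>)
  then show ?thesis by (simp add: D_def)
qed

text \<open>Twice the Lucas sequence $U_k(4, 1)$: the values are \<open>0, 2, 8, 30, 112, \<dots>\<close>\<close>
definition chain_seq :: "nat \<Rightarrow> real" where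
  "chain_seq k = ((2 + sqrt 3) ^ k - (2 - sqrt 3) ^ k) / sqrt 3"

lemma chain_seq_step: "chain_seq (k + 2) = 4 * chain_seq (k + 1) - chain_seq k"
proof -
  have power_step: "x ^ (k + 2) = 4 * x ^ (k + 1) - x ^ k" if "x ^ 2 = 4 * x - 1" for x :: real
    by (simp only: power_add that) (simp add: algebra_simps)
  have roots: "(2 + sqrt 3) ^ 2 = 4 * (2 + sqrt 3) - 1" "(2 - sqrt 3) ^ 2 = 4 * (2 - sqrt 3) - 1"
    by (simp_all add: power2_eq_square algebra_simps)
  have linear: "((4 * a' - a) - (4 * b' - b)) / s = 4 * ((a' - b') / s) - (a - b) / s"
    for a a' b b' s :: real
    by (simp add: diff_divide_distrib add_divide_distrib)
  show ?thesis
    unfolding chain_seq_def power_step[OF roots(1)] power_step[OF roots(2)] by (rule linear)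
qed

lemma chain_seq_base: "chain_seq 0 = 0" "chain_seq (Suc 0) = 2" "chain_seq 2 = 8"
  using chain_seq_step[of 0] by (auto simp: chain_seq_def eval_nat_numeral)

text \<open>
  The diagonal is \<open>3, 4, \<dots>, 4, 3\<close>. The leading minors \<open>1, 3, 11, 41, \<dots>\<close> are half the differences of
  consecutive values of the sequence; the last entry \<open>3\<close> instead of \<open>4\<close> turns the difference into a
  value of the sequence itself.
\<close>
lemma det_path_laplacian_plus_2:
  assumes "1 \<le> n"
  shows "det (mat (Suc n) (Suc n) (\<lambda>(i, j). path_laplacian n i j + 2 * of_bool (i = j))) =
    chain_seq (Suc n)"
proof -
  define D where
    "D k = (if k \<le> n then (chain_seq (k + 1) - chain_seq k) / 2 else chain_seq (Suc n))" for k
  have "det (mat (Suc n) (Suc n) (\<lambda>(i, j). path_laplacian n i j + 2 * of_bool (i = j))) = D (Suc n)"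
  proof (rule det_tridiagonal_recurrence[where M = "Suc n"])
    show "D 0 = 1" by (simp add: D_def chain_seq_base)
    show "D 1 = path_laplacian n 0 0 + 2 * of_bool (0 = (0::nat))"
      using assms by (simp add: D_def chain_seq_base path_laplacian_def numeral_2_eq_2[symmetric])
    fix k assume k: "k + 2 \<le> Suc n"
    show "D (k + 2) =
        (path_laplacian n (k + 1) (k + 1) + 2 * of_bool (k + 1 = k + 1)) * D (k + 1) -
        (path_laplacian n (k + 1) k + 2 * of_bool (k + 1 = k)) *
        (path_laplacian n k (k + 1) + 2 * of_bool (k = k + 1)) * D k"
      using k chain_seq_step[of k] chain_seq_step[of "k + 1"]
      by (cases "k + 2 \<le> n") (auto simp: D_def path_laplacian_def le_Suc_eq field_simps)
  qed (auto simp: path_laplacian_def)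
  then show ?thesis by (simp add: D_def)
qed

section \<open>Spanning trees of the polyomino chain\<close>

text \<open>The upper side comes first, from left to right, and then the lower side: index \<open>n + i\<close> is
  \<open>Lower i\<close>.\<close>
definition ladder_vertices :: "nat \<Rightarrow> nat \<Rightarrow> ladder_vertex" where
  "ladder_vertices n k = (if k < Suc n then Upper (Suc k) else Lower (k - n))"

lemma bij_ladder_vertices:
  "bij_betw (ladder_vertices n) {0..<Suc n + Suc n} (pverts (linear_polyomino_chain n))"
proof (rule bij_betwI')
  show "\<exists>x\<in>{0..<Suc n + Suc n}. y = ladder_vertices n x"
    if y: "y \<in> pverts (linear_polyomino_chain n)" for y
  proof -
    obtain i where "i \<in> {1..n + 1}" "y = Upper i \<or> y = Lower i"
      using y by (auto simp: linear_polyomino_chain_def)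
    then have "y = ladder_vertices n (i - 1) \<or> y = ladder_vertices n (i + n)"
        "i - 1 \<in> {0..<Suc n + Suc n}" "i + n \<in> {0..<Suc n + Suc n}"
      by (auto simp: ladder_vertices_def)
    then show ?thesis by blast
  qed
qed (auto simp: ladder_vertices_def linear_polyomino_chain_def image_iff)

lemma ladder_arcs:
  assumes "i \<le> n" "j \<le> n"
  shows "(Upper (Suc i), Upper (Suc j)) \<in> parcs (linear_polyomino_chain n) \<longleftrightarrow> j = Suc i \<or> i = Suc j"
    and "(Lower (Suc i), Lower (Suc j)) \<in> parcs (linear_polyomino_chain n) \<longleftrightarrow> j = Suc i \<or> i = Suc j"
    and "(Upper (Suc i), Lower (Suc j)) \<in> parcs (linear_polyomino_chain n) \<longleftrightarrow> i = j"
    and "(Lower (Suc i), Upper (Suc j)) \<in> parcs (linear_polyomino_chain n) \<longleftrightarrow> i = j"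
  using assms by (auto simp: linear_polyomino_chain_def polyomino_edges_def)

lemma ladder_degree:
  assumes "i \<le> n"
  shows "real (card (parcs (linear_polyomino_chain n) `` {Upper (Suc i)})) =
      1 + of_bool (0 < i) + of_bool (i < n)"
    and "real (card (parcs (linear_polyomino_chain n) `` {Lower (Suc i)})) =
      1 + of_bool (0 < i) + of_bool (i < n)"
proof -
  have "parcs (linear_polyomino_chain n) `` {Upper (Suc i)} =
      {Lower (Suc i)} \<union> (if 0 < i then {Upper i} else {}) \<union> (if i < n then {Upper (i + 2)} else {})"
    using assms by (auto simp: linear_polyomino_chain_def polyomino_edges_def)
  then show "real (card (parcs (linear_polyomino_chain n) `` {Upper (Suc i)})) =
      1 + of_bool (0 < i) + of_bool (i < n)"
    by simp
  have "parcs (linear_polyomino_chain n) `` {Lower (Suc i)} =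
      {Upper (Suc i)} \<union> (if 0 < i then {Lower i} else {}) \<union> (if i < n then {Lower (i + 2)} else {})"
    using assms by (auto simp: linear_polyomino_chain_def polyomino_edges_def)
  then show "real (card (parcs (linear_polyomino_chain n) `` {Lower (Suc i)})) =
      1 + of_bool (0 < i) + of_bool (i < n)"
    by simp
qed

text \<open>
  The perturbation is \<open>1\<close> at both ends of the first rung, so its sum is \<open>2\<close>. The rungs cancel in the
  sum of the blocks, which leaves a rooted path, and contribute twice the identity to their difference.
\<close>
theorem num_spanning_trees_linear_polyomino_chain:
  assumes n: "1 \<le> n"
  shows "2 * real (num_spanning_trees (linear_polyomino_chain n)) = chain_seq (n + 1)"
proof -
  define m where "m = Suc n"
  define x where "x j = (of_bool (j = 0 \<or> j = m) :: real)" for j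
  define f where "f i j = laplacian (linear_polyomino_chain n) (ladder_vertices n i) (ladder_vertices n j)
    + (if i = 0 then x j else 0)" for i j
  have f: "f i j = path_laplacian n i j + of_bool (i = j) + of_bool (i = 0 \<and> j = 0)"
      "f i (j + m) = - of_bool (i = j) + of_bool (i = 0 \<and> j = 0)"
      "f (i + m) j = - of_bool (i = j)"
      "f (i + m) (j + m) = path_laplacian n i j + of_bool (i = j)"
    if "i < m" "j < m" for i j
    using that
    by (auto simp: f_def m_def x_def laplacian_def ladder_vertices_def ladder_arcs ladder_degree
        path_laplacian_def)
  have "(\<Sum>j = 0..<m + m. x j) = (\<Sum>j\<in>{0, m}. x j)"
    by (rule sum.mono_neutral_right) (auto simp: x_def m_def)
  then have xsum: "(\<Sum>j = 0..<m + m. x j) = 2" by (simp add: x_def m_def)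
  have "2 * real (num_spanning_trees (linear_polyomino_chain n)) =
      det (mat (m + m) (m + m) (\<lambda>(i, j). f i j))"
    unfolding f_def
    using matrix_tree[OF pair_graph_linear_polyomino_chain bij_ladder_vertices, of n x] xsum
    by (simp add: m_def)
  also have "\<dots> = det (mat m m (\<lambda>(i, j). f i j + f (i + m) j)) *
      det (mat m m (\<lambda>(i, j). f (i + m) (j + m) - f (i + m) j))"
    by (rule det_folded_blocks) (simp add: f)
  also have "mat m m (\<lambda>(i, j). f i j + f (i + m) j) =
      mat m m (\<lambda>(i, j). path_laplacian n i j + of_bool (i = 0 \<and> j = 0))"
    by (rule cong_mat) (auto simp: f)
  also have "det \<dots> = 1" using det_path_laplacian_rooted[OF n] by (simp add: m_def)
  also have "mat m m (\<lambda>(i, j). f (i + m) (j + m) - f (i + m) j) =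
      mat m m (\<lambda>(i, j). path_laplacian n i j + 2 * of_bool (i = j))"
    by (rule cong_mat) (auto simp: f)
  also have "det \<dots> = chain_seq (n + 1)" using det_path_laplacian_plus_2[OF n] by (simp add: m_def)
  finally show ?thesis by simp
qed

text \<open>Each side has two corners, with factor \<open>3\<close>, and \<open>n - 1\<close> inner vertices, with factor \<open>4\<close>.\<close>
lemma prod_ladder_degrees:
  assumes n: "1 \<le> n"
  shows "(\<Prod>v\<in>pverts (linear_polyomino_chain n).
      real (card (parcs (linear_polyomino_chain n) `` {v})) + 1) = (9 * 4 ^ (n - 1)) ^ 2"
proof -
  let ?c = "\<lambda>v. real (card (parcs (linear_polyomino_chain n) `` {v})) + 1"
  obtain p where p: "n = Suc p" using n by (cases n) auto
  have side: "(\<Prod>i = 1..n + 1. 2 + of_bool (1 < i) + of_bool (i \<le> n)) = (9 * 4 ^ (n - 1) :: real)"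
  proof -
    have "(\<Prod>i = 1..n + 1. 2 + of_bool (1 < i) + of_bool (i \<le> n)) =
        (\<Prod>i = 0..<Suc (Suc p). 2 + of_bool (0 < i) + of_bool (i < n) :: real)"
      by (rule prod.reindex_bij_witness[where i = Suc and j = "\<lambda>i. i - 1"]) (auto simp: p)
    also have "\<dots> = 9 * (\<Prod>i = 0..<p. 4)"
      unfolding prod.atLeast0_lessThan_Suc_shift[of _ "Suc p"] comp_def
      unfolding prod.atLeast0_lessThan_Suc by (simp add: p)
    finally show ?thesis by (simp add: p)
  qed
  have "(\<Prod>v\<in>pverts (linear_polyomino_chain n). ?c v) =
      (\<Prod>i = 1..n + 1. ?c (Upper i)) * (\<Prod>i = 1..n + 1. ?c (Lower i))"
    by (simp add: linear_polyomino_chain_def)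
      (subst prod.union_disjoint, auto simp: prod.reindex inj_on_def)
  also have "(\<Prod>i = 1..n + 1. ?c (Upper i)) = 9 * 4 ^ (n - 1)"
    unfolding side[symmetric]
  proof (rule prod.cong[OF refl])
    fix i assume "i \<in> {1..n + 1}"
    then have "Suc (i - 1) = i" "i - 1 \<le> n" "0 < i - 1 \<longleftrightarrow> 1 < i" "i - 1 < n \<longleftrightarrow> i \<le> n" by auto
    then show "?c (Upper i) = 2 + of_bool (1 < i) + of_bool (i \<le> n)"
      using ladder_degree(1)[of "i - 1" n] by simp
  qed
  also have "(\<Prod>i = 1..n + 1. ?c (Lower i)) = 9 * 4 ^ (n - 1)"
    unfolding side[symmetric]
  proof (rule prod.cong[OF refl])
    fix i assume "i \<in> {1..n + 1}"
    then have "Suc (i - 1) = i" "i - 1 \<le> n" "0 < i - 1 \<longleftrightarrow> 1 < i" "i - 1 < n \<longleftrightarrow> i \<le> n" by auto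
    then show "?c (Lower i) = 2 + of_bool (1 < i) + of_bool (i \<le> n)"
      using ladder_degree(2)[of "i - 1" n] by simp
  qed
  finally show ?thesis by (simp add: power2_eq_square)
qed

section \<open>Spanning trees of the strong prism of the chain\<close>
theorem theorem3p5:
  fixes n :: nat
  assumes "n \<ge> 1"
  shows "real (num_spanning_trees (strong_prism (linear_polyomino_chain n))) =
    sqrt 3 * 27 * 2 ^ (8 * n - 3) * ((2 + sqrt 3) ^ (n + 1) - (2 - sqrt 3) ^ (n + 1))"
proof -
  define \<tau> where "\<tau> = real (num_spanning_trees (strong_prism (linear_polyomino_chain n)))"
  define S where "S = (2 + sqrt 3) ^ (n + 1) - (2 - sqrt 3) ^ (n + 1)"
  obtain p where p: "n = Suc p" using assms by (cases n) auto
  have nonempty: "pverts (linear_polyomino_chain n) \<noteq> {}" by (auto simp: linear_polyomino_chain_def)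
  define A :: real where "A = 4 ^ (2 * n + 2) * (9 * 4 ^ (n - 1)) ^ 2"
  have "4 * \<tau> = A * real (num_spanning_trees (linear_polyomino_chain n))"
    unfolding A_def using num_spanning_trees_strong_prism[OF pair_graph_linear_polyomino_chain nonempty]
    by (simp add: \<tau>_def card_verts_linear_polyomino_chain prod_ladder_degrees[OF assms])
  then have "8 * \<tau> = A * (2 * real (num_spanning_trees (linear_polyomino_chain n)))" by simp
  also have "2 * real (num_spanning_trees (linear_polyomino_chain n)) = S / sqrt 3"
    using num_spanning_trees_linear_polyomino_chain[OF assms] by (simp add: S_def chain_seq_def)
  also have "A = 81 * 4 ^ (4 * p + 4)"
    by (simp add: A_def p power_mult_distrib power_add power_mult power2_eq_square)
      (simp flip: power_mult_distrib)
  also have "S / sqrt 3 = sqrt 3 * S / 3" by (simp add: field_simps)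
  also have "(4::real) ^ (4 * p + 4) = 8 * 2 ^ (8 * n - 3)"
  proof -
    have "8 * n - 3 = 8 * p + 5" using p by simp
    moreover have "(4::real) ^ (4 * p + 4) = 2 ^ (2 * (4 * p + 4))" by (subst power_mult) simp
    ultimately show ?thesis by (simp add: power_add)
  qed
  finally show ?thesis by (simp add: \<tau>_def S_def)
qed

end
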